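(* Let $(X,p)$ be a partial metric space and let $a$ be a fixed positive real number such that $p(\xi,\xi)=a$ for all $\xi\in X$. Let $\mathcal{I}$ be a non-trivial admissible ideal of $\mathbb{N}$ and let $r\ge 0$. Then for every sequence $\{\xi_n\}$ in $X$, $\operatorname{diam}(\mathcal{I}\text{-}st\text{-}LIM^{r}\xi_n)\le 2r+2a$.
   Context: A partial metric on a non-empty set $X$ is a function $p:X\times X\to[0,\infty)$ such that for all $x,y,z\in X$: (p1) $0\le p(x,x)\le p(x,y)$; (p2) $x=y$ if and only if $p(x,x)=p(x,y)=p(y,y)$; (p3) $p(x,y)=p(y,x)$; (p4) $p(x,y)\le p(x,z)+p(z,y)-p(z,z)$. Then $(X,p)$ is called a partial metric space. An ideal of $\mathbb{N}$ is a family $\mathcal{I}\subset 2^{\mathbb{N}}$ containing $\emptyset$, closed under finite unions and under taking subsets; it is non-trivial if $\mathcal{I}\ne 2^{\mathbb{N}}$ and $\mathcal{I}\neq\{\emptyset\}$, and a non-trivial ideal is admissible if $\{n\}\in\mathcal{I}$ for every $n\in\mathbb{N}$. A sequence $\{\xi_n\}$ in $X$ is rough $\mathcal{I}$-statistically convergent to $\xi\in X$ of roughness degree $r\ge 0$ if for every $\varepsilon>0$ and $\delta>0$, $\left\{n\in\mathbb{N}:\frac{1}{n}\left|\{k\le n:|p(\xi_k,\xi)-p(\xi,\xi)|\ge r+\varepsilon\}\right|\ge\delta\right\}\in\mathcal{I}$. The set of all such $\xi\in X$ is the rough $\mathcal{I}$-statistical limit set, denoted $\mathcal{I}\text{-}st\text{-}LIM^{r}\xi_n$.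 The diameter of $B\subset X$ is $\operatorname{diam}(B)=\sup\{p(x,y):x,y\in B\}$ (with the supremum of the empty set taken to be $0$). *)

theory Defs
  imports Complex_Main "HOL-Library.Extended_Real"
begin

locale partial_metric_space =
  fixes X :: "'a set" and p :: "'a \<Rightarrow> 'a \<Rightarrow> real"
  assumes nonempty: "X \<noteq> {}"
    and self_nonneg: "x \<in> X \<Longrightarrow> 0 \<le> p x x"
    and self_le: "x \<in> X \<Longrightarrow> y \<in> X \<Longrightarrow> p x x \<le> p x y"
    and eq_iff: "x \<in> X \<Longrightarrow> y \<in> X \<Longrightarrow> x = y \<longleftrightarrow> p x x = p x y \<and> p x y = p y y"
    and sym: "x \<in> X \<Longrightarrow> y \<in> X \<Longrightarrow> p x y = p y x"
    and triangle: "x \<in> X \<Longrightarrow> y \<in> X \<Longrightarrow> z \<in> X \<Longrightarrow> p x y \<le> p x z + p z y - p z z"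

text \<open>The index set of sequences and the ground set of ideals is the set of positive
  integers, rendered as the subset \<open>{1..}\<close> of type \<open>nat\<close>; the value of a sequence
  at \<open>0\<close> is never used.\<close>

abbreviation pos_nats :: "nat set" where
  "pos_nats \<equiv> {1..}"

definition set_ideal :: "nat set set \<Rightarrow> bool" where
  "set_ideal \<I> \<longleftrightarrow> \<I> \<subseteq> Pow pos_nats \<and> {} \<in> \<I> \<and>
     (\<forall>A\<in>\<I>. \<forall>B\<in>\<I>. A \<union> B \<in> \<I>) \<and> (\<forall>A\<in>\<I>. \<forall>B. B \<subseteq> A \<longrightarrow> B \<in> \<I>)"

definition nontrivial_ideal :: "nat set set \<Rightarrow> bool" where
  "nontrivial_ideal \<I> \<longleftrightarrow> set_ideal \<I> \<and> \<I> \<noteq> Pow pos_nats \<and> \<I> \<noteq> {{}}"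

definition admissible_ideal :: "nat set set \<Rightarrow> bool" where
  "admissible_ideal \<I> \<longleftrightarrow> nontrivial_ideal \<I> \<and> (\<forall>n\<in>pos_nats. {n} \<in> \<I>)"

definition rough_ideal_st_conv ::
  "('a \<Rightarrow> 'a \<Rightarrow> real) \<Rightarrow> nat set set \<Rightarrow> real \<Rightarrow> (nat \<Rightarrow> 'a) \<Rightarrow> 'a \<Rightarrow> bool" where
  "rough_ideal_st_conv p \<I> r \<xi> x \<longleftrightarrow>
     (\<forall>\<epsilon>>0. \<forall>\<delta>>0.
        {n \<in> pos_nats.
           1 / real n * real (card {k \<in> pos_nats. k \<le> n \<and> \<bar>p (\<xi> k) x - p x x\<bar> \<ge> r + \<epsilon>}) \<ge> \<delta>} \<in> \<I>)"

definition rough_ideal_st_LIM ::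
  "'a set \<Rightarrow> ('a \<Rightarrow> 'a \<Rightarrow> real) \<Rightarrow> nat set set \<Rightarrow> real \<Rightarrow> (nat \<Rightarrow> 'a) \<Rightarrow> 'a set" where
  "rough_ideal_st_LIM X p \<I> r \<xi> = {x \<in> X. rough_ideal_st_conv p \<I> r \<xi> x}"

text \<open>The diameter is extended-real-valued, so that it is \<open>\<infinity>\<close> on unbounded sets (a
  supremum in type \<open>real\<close> would be unspecified there). The empty set needs its own
  case because the supremum of the empty set in type \<open>ereal\<close> is \<open>-\<infinity>\<close>.\<close>

definition pm_diam :: "('a \<Rightarrow> 'a \<Rightarrow> real) \<Rightarrow> 'a set \<Rightarrow> ereal" where
  "pm_diam p B = (if B = {} then 0 else Sup {ereal (p x y) |x y. x \<in> B \<and> y \<in> B})"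

end

theory Submission
  imports Defs
begin

text \<open>If two points lie in the limit set, then outside a set of the ideal the exceptional
  indices \<open>k \<le> n\<close> of each point number fewer than \<open>n / 2\<close>. As the ideal is proper, this
  holds for some \<open>n\<close>, so some \<open>k \<le> n\<close> is good for both points, and the triangle inequality
  through \<open>\<xi> k\<close> bounds their distance.\<close>

text \<open>Closure under subsets would otherwise force \<I> to be all of
  \<open>Pow pos_nats\<close>.\<close>

lemma nontrivial_ideal_pos_nats_notin:
  assumes "nontrivial_ideal \<I>"
  shows "pos_nats \<notin> \<I>"
  using assms unfolding nontrivial_ideal_def set_ideal_def by blast

lemma rough_ideal_st_conv_common_index:
  assumes \<I>: "nontrivial_ideal \<I>"
    and x: "rough_ideal_st_conv p \<I> r \<xi> x"
    and y: "rough_ideal_st_conv p \<I> r \<xi> y"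
    and "\<epsilon> > 0"
  obtains k where "k \<in> pos_nats" "\<bar>p (\<xi> k) x - p x x\<bar> < r + \<epsilon>" "\<bar>p (\<xi> k) y - p y y\<bar> < r + \<epsilon>"
proof -
  define B where "B z n = {k \<in> pos_nats. k \<le> n \<and> \<bar>p (\<xi> k) z - p z z\<bar> \<ge> r + \<epsilon>}" for z n
  \<comment> \<open>The density threshold is 1/2 because two subsets of \<open>{1..n}\<close>, each
    with fewer than n/2 elements, cannot cover it.\<close>
  define A where "A z = {n \<in> pos_nats. 1 / real n * real (card (B z n)) \<ge> 1/2}" for z
  have half: "(1/2 :: real) > 0"
    by simp
  have "A x \<in> \<I>" "A y \<in> \<I>"
    unfolding A_def B_def
    using x[unfolded rough_ideal_st_conv_def, rule_format, OF \<open>\<epsilon> > 0\<close> half]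
      y[unfolded rough_ideal_st_conv_def, rule_format, OF \<open>\<epsilon> > 0\<close> half] .
  then have "A x \<union> A y \<in> \<I>"
    using \<I> unfolding nontrivial_ideal_def set_ideal_def by blast
  then have "A x \<union> A y \<noteq> pos_nats"
    using nontrivial_ideal_pos_nats_notin[OF \<I>] by metis
  moreover have "A x \<union> A y \<subseteq> pos_nats"
    by (auto simp: A_def)
  ultimately obtain n where n: "n \<in> pos_nats" "n \<notin> A x" "n \<notin> A y"
    by blast
  \<comment> \<open>Clearing the factor \<open>1 / real n\<close> relies on n being
    positive.\<close>
  then have "real (card (B x n)) < real n / 2" "real (card (B y n)) < real n / 2"
    by (auto simp: A_def field_simps)
  then have "card (B x n \<union> B y n) < card {1..n}"
    using card_Un_le[of "B x n" "B y n"] by simp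
  moreover have "finite (B x n \<union> B y n)"
    by (simp add: B_def)
  \<comment> \<open>If the finite union contained \<open>{1..n}\<close>, its cardinality would be at
    least n.\<close>
  ultimately obtain k where "k \<in> {1..n}" "k \<notin> B x n \<union> B y n"
    by (meson card_mono leD subsetI)
  then show thesis
    using that[of k] by (auto simp: B_def)
qed

text \<open>Each point contributes r plus its own self-distance. Keeping the self-distances separate
  gives a bound valid in every partial metric space; constant self-distance a turns it into 2r +
  2a.\<close>

lemma (in partial_metric_space) rough_ideal_st_LIM_dist_le:
  assumes \<I>: "nontrivial_ideal \<I>"
    and \<xi>: "\<And>n. n \<in> pos_nats \<Longrightarrow> \<xi> n \<in> X"
    and x: "x \<in> rough_ideal_st_LIM X p \<I> r \<xi>"
    and y: "y \<in> rough_ideal_st_LIM X p \<I> r \<xi>"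
  shows "p x y \<le> 2 * r + p x x + p y y"
\<comment> \<open>Convergence controls distances only up to r + \<epsilon> with \<epsilon> > 0, so a
  slack e is allowed and split evenly between the two points.\<close>
proof (rule field_le_epsilon)
  fix e :: real assume "e > 0"
  have "x \<in> X" "y \<in> X" "rough_ideal_st_conv p \<I> r \<xi> x" "rough_ideal_st_conv p \<I> r \<xi> y"
    using x y by (auto simp: rough_ideal_st_LIM_def)
  then obtain k where k: "k \<in> pos_nats"
      "\<bar>p (\<xi> k) x - p x x\<bar> < r + e / 2" "\<bar>p (\<xi> k) y - p y y\<bar> < r + e / 2"
    using rough_ideal_st_conv_common_index[OF \<I>, of p r \<xi> x y "e / 2"] \<open>e > 0\<close> by auto
  have "p x y \<le> p x (\<xi> k) + p (\<xi> k) y - p (\<xi> k) (\<xi> k)"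
    using triangle \<xi> k(1) \<open>x \<in> X\<close> \<open>y \<in> X\<close> by blast
  \<comment> \<open>The subtracted self-distance of \<open>\<xi> k\<close> is nonnegative, so
    dropping it only enlarges the bound.\<close>
  also have "\<dots> \<le> p (\<xi> k) x + p (\<xi> k) y"
    using sym[OF \<open>x \<in> X\<close> \<xi>[OF k(1)]] self_nonneg[OF \<xi>[OF k(1)]] by simp
  also have "\<dots> \<le> 2 * r + p x x + p y y + e"
    using k(2,3) by linarith
  finally show "p x y \<le> 2 * r + p x x + p y y + e" .
qed

theorem theorem3p2:
  fixes X :: "'a set" and p :: "'a \<Rightarrow> 'a \<Rightarrow> real" and a r :: real
    and \<I> :: "nat set set" and \<xi> :: "nat \<Rightarrow> 'a"
  assumes "partial_metric_space X p"
    and "a > 0"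
    and "\<And>x. x \<in> X \<Longrightarrow> p x x = a"
    and "admissible_ideal \<I>"
    and "r \<ge> 0"
    and "\<And>n. n \<in> pos_nats \<Longrightarrow> \<xi> n \<in> X"
  shows "pm_diam p (rough_ideal_st_LIM X p \<I> r \<xi>) \<le> ereal (2 * r + 2 * a)"
proof -
  let ?L = "rough_ideal_st_LIM X p \<I> r \<xi>"
  have "p x y \<le> 2 * r + 2 * a" if "x \<in> ?L" "y \<in> ?L" for x y
  proof -
    have "nontrivial_ideal \<I>"
      using assms(4) by (simp add: admissible_ideal_def)
    then have "p x y \<le> 2 * r + p x x + p y y"
      using partial_metric_space.rough_ideal_st_LIM_dist_le assms(1,6) that by metis
    moreover have "p x x = a" "p y y = a"
      using that assms(3) by (auto simp: rough_ideal_st_LIM_def)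
    ultimately show ?thesis by simp
  qed
  \<comment> \<open>An empty limit set has diameter 0 by convention; there the claim is 0 \<le> 2r +
    2a, which follows from the signs of r and a.\<close>
  then show ?thesis
    using assms(2,5) by (auto simp: pm_diam_def intro!: Sup_least)
qed

end
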